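(* Let $f_1,\dots,f_m:\mathbb{R}^n\to\mathbb{R}$ be convex and continuously differentiable, and suppose that for each $i$ there is a constant $L_i$ with $\|\nabla f_i(x)-\nabla f_i(y)\|\le L_i\|x-y\|$ for all $x,y\in\mathbb{R}^n$. Let $F=(f_1,\dots,f_m)$ and suppose that for every $\bar x\in\mathbb{R}^n$ the level set $\mathcal{L}(F,F(\bar x))=\{x\in\mathbb{R}^n: f_i(x)\le f_i(\bar x),\ i=1,\dots,m\}$ is bounded. Let $x:[1,+\infty)\to\mathbb{R}^n$ be a solution of the Cauchy problem $$\frac{\alpha}{t}\dot x(t)+\mathrm{proj}_{C(x(t))+\ddot x(t)}(0)=0,\qquad x(1)=x_0,\quad \dot x(1)=0,$$ with $\alpha=3$. Then $x(t)$ converges (as $t\to\infty$) to the set of weakly Pareto optimal solutions of $\min_{x\in\mathbb{R}^n}F(x)$.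
   Context: $\mathbb{R}^n$ carries the Euclidean inner product and norm. $C(x):=\mathrm{conv}\{\nabla f_i(x): i=1,\dots,m\}$ is the convex hull of the gradients, $C(x(t))+\ddot x(t)=\{\xi+\ddot x(t):\xi\in C(x(t))\}$, and $\mathrm{proj}_K(v)$ is the Euclidean projection of $v$ onto the closed convex set $K$. A solution of the Cauchy problem (with given $x_0\in\mathbb{R}^n$) is a continuously differentiable function $x:[1,+\infty)\to\mathbb{R}^n$ whose derivative $\dot x$ is absolutely continuous on every compact subinterval of $[1,+\infty)$, which satisfies the differential equation for almost all $t\ge1$ and satisfies the initial conditions. A point $x^*\in\mathbb{R}^n$ is weakly Pareto optimal if there is no $y\in\mathbb{R}^n$ with $f_i(y)<f_i(x^* )$ for all $i=1,\dots,m$; the set of weakly Pareto optimal solutions is the set of all such points. *)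

theory Defs
  imports "HOL-Analysis.Analysis"
begin

text \<open>
  The objectives are a family \<open>f :: 'm \<Rightarrow> real ^ 'n \<Rightarrow> real\<close> indexed by a finite type,
  so that \<open>m = CARD('m) \<ge> 1\<close> and \<open>n = CARD('n) \<ge> 1\<close>; \<open>g i\<close> stands for the gradient of \<open>f i\<close>.
\<close>

definition level_set :: "('m \<Rightarrow> 'a \<Rightarrow> real) \<Rightarrow> ('m \<Rightarrow> real) \<Rightarrow> 'a set" where
  "level_set f c = {x. \<forall>i. f i x \<le> c i}"

definition weakly_pareto_set :: "('m \<Rightarrow> 'a \<Rightarrow> real) \<Rightarrow> 'a set" where
  "weakly_pareto_set f = {x. \<not> (\<exists>y. \<forall>i. f i y < f i x)}"

definition gradient_hull :: "('m::finite \<Rightarrow> real ^ 'n \<Rightarrow> real ^ 'n) \<Rightarrow> real ^ 'n \<Rightarrow> (real ^ 'n) set" where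
  "gradient_hull g x = convex hull (range (\<lambda>i. g i x))"

text \<open>
  Absolute continuity of a function on a set of reals, in the epsilon-delta sense (the library
  constant \<open>absolutely_continuous\<close> is about measures). Degenerate intervals \<open>l k = r k\<close> are
  allowed; they contribute nothing to either sum.
\<close>

definition abs_continuous_on :: "real set \<Rightarrow> (real \<Rightarrow> 'a::real_normed_vector) \<Rightarrow> bool" where
  "abs_continuous_on S v \<longleftrightarrow>
    (\<forall>e>0. \<exists>d>0. \<forall>(N::nat) l r.
      (\<forall>k<N. l k \<le> r k \<and> {l k..r k} \<subseteq> S) \<longrightarrow>
      disjoint_family_on (\<lambda>k. {l k<..<r k}) {..<N} \<longrightarrow>
      (\<Sum>k<N. r k - l k) < d \<longrightarrow>
      (\<Sum>k<N. norm (v (r k) - v (l k))) < e)"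

text \<open>
  Trajectories are total functions of which only the values on \<open>{1..}\<close> matter, so derivatives of
  \<open>x\<close> are taken within \<open>{1..}\<close> (one-sided at \<open>1\<close>). The velocity \<open>v\<close> is thereby
  uniquely determined on \<open>{1..}\<close>; the existence of the acceleration \<open>a\<close> is required only
  almost everywhere.
\<close>

definition cauchy_solution ::
  "real \<Rightarrow> ('m::finite \<Rightarrow> real ^ 'n \<Rightarrow> real ^ 'n) \<Rightarrow> real ^ 'n \<Rightarrow> (real \<Rightarrow> real ^ 'n) \<Rightarrow> bool" where
  "cauchy_solution \<alpha> g x0 x \<longleftrightarrow>
    (\<exists>v. (\<forall>t\<ge>1. (x has_vector_derivative v t) (at t within {1..})) \<and>
         continuous_on {1..} v \<and>
         (\<forall>a b. 1 \<le> a \<and> a \<le> b \<longrightarrow> abs_continuous_on {a..b} v) \<and>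
         (AE t in lebesgue. 1 \<le> t \<longrightarrow>
            (\<exists>a. (v has_vector_derivative a) (at t within {1..}) \<and>
                 (\<alpha> / t) *\<^sub>R v t + closest_point ((\<lambda>\<xi>. \<xi> + a) ` gradient_hull g (x t)) 0 = 0)) \<and>
         x 1 = x0 \<and> v 1 = 0)"

text \<open>
  Convergence of a trajectory to a set: the distance to the set tends to zero. Nonemptiness is
  required because of the library convention \<open>infdist x {} = 0\<close>.
\<close>

definition converges_to_set :: "(real \<Rightarrow> 'a::metric_space) \<Rightarrow> 'a set \<Rightarrow> bool" where
  "converges_to_set x S \<longleftrightarrow> S \<noteq> {} \<and> ((\<lambda>t. infdist (x t) S) \<longlongrightarrow> 0) at_top"

end

theory Submission
  imports Defs
begin

text \<open>
  The proof rests on a Lyapunov function. Put \<open>v\<close> for the velocity and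
  \<open>\<xi> = - (a + (3 / t) v)\<close>, \<open>a\<close> being the acceleration. The projection equation means
  that \<open>\<xi>\<close> lies in the convex hull of the gradients and that
  \<open>g i x \<bullet> v \<le> \<xi> \<bullet> v\<close> for all \<open>i\<close> (\<open>projection_velocity_inequality\<close>).

  For a fixed reference point \<open>z\<close> consider
  \<open>E i t = t\<^sup>2 (f i (x t) - f i z) + \<bar>2 (x t - z) + t v t\<bar>\<^sup>2 / 2\<close>. Wherever \<open>i\<close>
  minimizes \<open>E i t\<close>, convexity and the inequality above make the derivative of \<open>E i\<close>
  nonpositive, so that the minimum over \<open>i\<close> is nonincreasing (\<open>lyapunov_nonincreasing\<close>).
  Therefore the smallest of the gaps \<open>f i (x t) - f i z\<close> is at most a constant, depending
  on \<open>z\<close>, divided by \<open>t\<^sup>2\<close>, and no \<open>z\<close> can be strictly better in every objective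
  than a limit point of the trajectory: all limit points are weakly Pareto optimal
  (\<open>limit_point_weakly_pareto\<close>).

  Each mechanical energy \<open>f i (x t) + \<bar>v t\<bar>\<^sup>2 / 2\<close> is nonincreasing as well, so a
  trajectory starting at rest stays in the level set of its starting point and is
  bounded. A bounded trajectory converges to any set that contains its limit points, and such limit
  points exist (\<open>converges_to_set_if_limit_points\<close>).

  The acceleration exists only almost everywhere, and the minimum over \<open>i\<close> has kinks. Both
  are dealt with by \<open>min_family_nonincreasing\<close>: the minimum of finitely many absolutely
  continuous functions is nonincreasing if at almost every time the members attaining it
  have nonpositive derivatives.
\<close>

section \<open>Absolutely continuous functions\<close>
lemma abs_continuous_on_subset:
  assumes "abs_continuous_on S u" and "T \<subseteq> S"
  shows "abs_continuous_on T u"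
  unfolding abs_continuous_on_def
proof (intro allI impI)
  fix e :: real
  assume "e > 0"
  then obtain d where "d > 0" and d: "\<And>(N::nat) l r. \<lbrakk>\<forall>k<N. l k \<le> r k \<and> {l k..r k} \<subseteq> S;
      disjoint_family_on (\<lambda>k. {l k<..<r k}) {..<N}; (\<Sum>k<N. r k - l k) < d\<rbrakk>
      \<Longrightarrow> (\<Sum>k<N. norm (u (r k) - u (l k))) < e"
    using assms(1) unfolding abs_continuous_on_def by blast
  show "\<exists>d>0. \<forall>(N::nat) l r. (\<forall>k<N. l k \<le> r k \<and> {l k..r k} \<subseteq> T) \<longrightarrow>
      disjoint_family_on (\<lambda>k. {l k<..<r k}) {..<N} \<longrightarrow> (\<Sum>k<N. r k - l k) < d \<longrightarrow>
      (\<Sum>k<N. norm (u (r k) - u (l k))) < e"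
    using \<open>d > 0\<close> assms(2) by (intro exI[of _ d] conjI allI impI d) blast+
qed

text \<open>
  All closure properties below come from this comparison: a function whose increments are
  controlled by those of two absolutely continuous functions is absolutely continuous.
\<close>
lemma abs_continuous_on_dominated:
  fixes F :: "real \<Rightarrow> 'a::real_normed_vector" and u :: "real \<Rightarrow> 'b::real_normed_vector"
    and w :: "real \<Rightarrow> 'c::real_normed_vector"
  assumes u: "abs_continuous_on S u" and w: "abs_continuous_on S w"
    and dom: "\<And>l r. \<lbrakk>l \<in> S; r \<in> S; l \<le> r\<rbrakk> \<Longrightarrow>
                norm (F r - F l) \<le> K * (norm (u r - u l) + norm (w r - w l))"
  shows "abs_continuous_on S F"
  unfolding abs_continuous_on_def
proof (intro allI impI)
  fix e :: real
  assume "e > 0"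
  define K' where "K' = \<bar>K\<bar> + 1"
  define e' where "e' = e / (2 * K')"
  have "K' > 0" unfolding K'_def by simp
  then have "e' > 0" using \<open>e > 0\<close> by (simp add: e'_def)
  obtain d1 where "d1 > 0" and d1: "\<And>(N::nat) l r. \<lbrakk>\<forall>k<N. l k \<le> r k \<and> {l k..r k} \<subseteq> S;
      disjoint_family_on (\<lambda>k. {l k<..<r k}) {..<N}; (\<Sum>k<N. r k - l k) < d1\<rbrakk>
      \<Longrightarrow> (\<Sum>k<N. norm (u (r k) - u (l k))) < e'"
    using u \<open>e' > 0\<close> unfolding abs_continuous_on_def by blast
  obtain d2 where "d2 > 0" and d2: "\<And>(N::nat) l r. \<lbrakk>\<forall>k<N. l k \<le> r k \<and> {l k..r k} \<subseteq> S;
      disjoint_family_on (\<lambda>k. {l k<..<r k}) {..<N}; (\<Sum>k<N. r k - l k) < d2\<rbrakk>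
      \<Longrightarrow> (\<Sum>k<N. norm (w (r k) - w (l k))) < e'"
    using w \<open>e' > 0\<close> unfolding abs_continuous_on_def by blast
  show "\<exists>d>0. \<forall>(N::nat) l r. (\<forall>k<N. l k \<le> r k \<and> {l k..r k} \<subseteq> S) \<longrightarrow>
      disjoint_family_on (\<lambda>k. {l k<..<r k}) {..<N} \<longrightarrow> (\<Sum>k<N. r k - l k) < d \<longrightarrow>
      (\<Sum>k<N. norm (F (r k) - F (l k))) < e"
  proof (intro exI[of _ "min d1 d2"] conjI allI impI)
    show "min d1 d2 > 0" using \<open>d1 > 0\<close> \<open>d2 > 0\<close> by simp
    fix N :: nat and l r :: "nat \<Rightarrow> real"
    assume lr: "\<forall>k<N. l k \<le> r k \<and> {l k..r k} \<subseteq> S"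
      and disj: "disjoint_family_on (\<lambda>k. {l k<..<r k}) {..<N}"
      and small: "(\<Sum>k<N. r k - l k) < min d1 d2"
    have "norm (F (r k) - F (l k)) \<le> K' * (norm (u (r k) - u (l k)) + norm (w (r k) - w (l k)))"
      if "k < N" for k
    proof -
      have "l k \<le> r k" "{l k..r k} \<subseteq> S" using lr that by auto
      then have "l k \<in> S" "r k \<in> S" by auto
      then have "norm (F (r k) - F (l k)) \<le> K * (norm (u (r k) - u (l k)) + norm (w (r k) - w (l k)))"
        using dom \<open>l k \<le> r k\<close> by blast
      also have "\<dots> \<le> K' * (norm (u (r k) - u (l k)) + norm (w (r k) - w (l k)))"
        unfolding K'_def by (intro mult_right_mono) auto
      finally show ?thesis .
    qed
    then have "(\<Sum>k<N. norm (F (r k) - F (l k)))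
        \<le> (\<Sum>k<N. K' * (norm (u (r k) - u (l k)) + norm (w (r k) - w (l k))))"
      by (intro sum_mono) auto
    also have "\<dots> = K' * ((\<Sum>k<N. norm (u (r k) - u (l k))) + (\<Sum>k<N. norm (w (r k) - w (l k))))"
      by (simp add: sum_distrib_left[symmetric] sum.distrib)
    also have "\<dots> < K' * (e' + e')"
      using \<open>K' > 0\<close> d1[OF lr disj] d2[OF lr disj] small by (intro mult_strict_left_mono) auto
    also have "\<dots> = e" using \<open>K' > 0\<close> by (simp add: e'_def)
    finally show "(\<Sum>k<N. norm (F (r k) - F (l k))) < e" .
  qed
qed

lemma abs_continuous_on_ident: "abs_continuous_on S (\<lambda>t. t)"
  unfolding abs_continuous_on_def
proof (intro allI impI)
  fix e :: real
  assume "e > 0"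
  show "\<exists>d>0. \<forall>(N::nat) l r. (\<forall>k<N. l k \<le> r k \<and> {l k..r k} \<subseteq> S) \<longrightarrow>
      disjoint_family_on (\<lambda>k. {l k<..<r k}) {..<N} \<longrightarrow> (\<Sum>k<N. r k - l k) < d \<longrightarrow>
      (\<Sum>k<N. norm (r k - l k)) < e"
  proof (intro exI[of _ e] conjI allI impI)
    show "e > 0" by fact
    fix N :: nat and l r :: "nat \<Rightarrow> real"
    assume "\<forall>k<N. l k \<le> r k \<and> {l k..r k} \<subseteq> S" and "(\<Sum>k<N. r k - l k) < e"
    moreover from this have "(\<Sum>k<N. norm (r k - l k)) = (\<Sum>k<N. r k - l k)"
      by (intro sum.cong) auto
    ultimately show "(\<Sum>k<N. norm (r k - l k)) < e" by simp
  qed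
qed

lemma abs_continuous_on_add:
  assumes "abs_continuous_on S u" and "abs_continuous_on S w"
  shows "abs_continuous_on S (\<lambda>t. u t + w t)"
proof (rule abs_continuous_on_dominated[OF assms, where K = 1])
  fix l r :: real
  show "norm (u r + w r - (u l + w l)) \<le> 1 * (norm (u r - u l) + norm (w r - w l))"
    using norm_triangle_ineq[of "u r - u l" "w r - w l"] by (simp add: algebra_simps)
qed

lemma (in bounded_bilinear) abs_continuous_on:
  assumes u: "abs_continuous_on {a..b} u" "continuous_on {a..b} u"
    and w: "abs_continuous_on {a..b} w" "continuous_on {a..b} w"
  shows "abs_continuous_on {a..b} (\<lambda>t. prod (u t) (w t))"
proof -
  have "bounded (u ` {a..b})" "bounded (w ` {a..b})"
    using u(2) w(2) by (auto intro!: compact_imp_bounded compact_continuous_image)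
  then obtain U W where U: "\<And>t. t \<in> {a..b} \<Longrightarrow> norm (u t) \<le> U"
    and W: "\<And>t. t \<in> {a..b} \<Longrightarrow> norm (w t) \<le> W"
    unfolding bounded_iff by blast
  obtain K where "K \<ge> 0" and K: "\<And>y z. norm (prod y z) \<le> norm y * norm z * K"
    using nonneg_bounded by blast
  show ?thesis
  proof (rule abs_continuous_on_dominated[OF u(1) w(1), where K = "K * max U W"])
    fix l r
    assume lr: "l \<in> {a..b}" "r \<in> {a..b}"
    have "prod (u r) (w r) - prod (u l) (w l) = prod (u r - u l) (w r) + prod (u l) (w r - w l)"
      by (simp add: diff_left diff_right)
    then have "norm (prod (u r) (w r) - prod (u l) (w l))
        \<le> norm (prod (u r - u l) (w r)) + norm (prod (u l) (w r - w l))"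
      by (simp add: norm_triangle_ineq)
    also have "\<dots> \<le> norm (u r - u l) * norm (w r) * K + norm (u l) * norm (w r - w l) * K"
      by (intro add_mono K)
    also have "\<dots> \<le> norm (u r - u l) * max U W * K + max U W * norm (w r - w l) * K"
      using U[OF lr(1)] W[OF lr(2)] \<open>K \<ge> 0\<close>
      by (intro add_mono mult_right_mono mult_left_mono) auto
    finally show "norm (prod (u r) (w r) - prod (u l) (w l))
        \<le> K * max U W * (norm (u r - u l) + norm (w r - w l))"
      by (simp add: algebra_simps)
  qed
qed

lemma abs_continuous_on_C1:
  fixes u :: "real \<Rightarrow> 'a::real_normed_vector"
  assumes deriv: "\<And>t. t \<in> {a..b} \<Longrightarrow> (u has_vector_derivative u' t) (at t within {a..b})"
    and cont: "continuous_on {a..b} u'"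
  shows "abs_continuous_on {a..b} u"
proof -
  have "bounded (u' ` {a..b})"
    using cont by (auto intro!: compact_imp_bounded compact_continuous_image)
  then obtain B where B: "\<And>t. t \<in> {a..b} \<Longrightarrow> norm (u' t) \<le> B"
    unfolding bounded_iff by blast
  show ?thesis
  proof (rule abs_continuous_on_dominated[OF abs_continuous_on_ident abs_continuous_on_ident,
        where K = "B / 2"])
    fix l r
    assume "l \<in> {a..b}" "r \<in> {a..b}"
    then have "norm (u r - u l) \<le> B * norm (r - l)"
      using deriv B by (intro differentiable_bound[where f' = "\<lambda>t h. h *\<^sub>R u' t" and S = "{a..b}"])
        (auto simp: has_vector_derivative_def onorm_scaleR_left[OF bounded_linear_ident] onorm_id)
    then show "norm (u r - u l) \<le> B / 2 * (norm (r - l) + norm (r - l))" by simp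
  qed
qed

lemma abs_continuous_on_Min:
  fixes \<phi> :: "'i \<Rightarrow> real \<Rightarrow> real"
  assumes "finite A" and "A \<noteq> {}" and "\<And>i. i \<in> A \<Longrightarrow> abs_continuous_on S (\<phi> i)"
  shows "abs_continuous_on S (\<lambda>t. MIN i\<in>A. \<phi> i t)"
  using assms
proof (induction rule: finite_ne_induct)
  case (singleton i)
  then show ?case by simp
next
  case (insert i A)
  then have "abs_continuous_on S (\<phi> i)" and "abs_continuous_on S (\<lambda>t. MIN i\<in>A. \<phi> i t)"
    by auto
  then have "abs_continuous_on S (\<lambda>t. min (\<phi> i t) (MIN i\<in>A. \<phi> i t))"
    by (rule abs_continuous_on_dominated[where K = 1]) auto
  then show ?case using insert.hyps by (simp add: Min_insert)
qed

section \<open>Monotonicity from an almost everywhere derivative\<close>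
lemma nonoverlapping_lengths_le_measure:
  fixes l r :: "nat \<Rightarrow> real"
  assumes "\<And>k. k < n \<Longrightarrow> l k \<le> r k" and "\<And>k. k < n \<Longrightarrow> {l k<..<r k} \<subseteq> T"
    and "disjoint_family_on (\<lambda>k. {l k<..<r k}) {..<n}" and "T \<in> lmeasurable"
  shows "(\<Sum>k<n. r k - l k) \<le> measure lebesgue T"
proof -
  have "(\<Sum>k<n. r k - l k) = (\<Sum>k<n. measure lebesgue {l k<..<r k})"
    using assms(1) by (intro sum.cong) auto
  also have "\<dots> = measure lebesgue (\<Union>k<n. {l k<..<r k})"
    using assms(1,3) by (intro measure_finite_Union[symmetric]) auto
  also have "\<dots> \<le> measure lebesgue T"
    using assms(2,4) by (intro measure_mono_fmeasurable) (auto intro!: sets.finite_UN)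
  finally show ?thesis .
qed

text \<open>
  Absolute continuity in the form in which a gauge argument consumes it: the tagged intervals
  caught by a set of small measure contribute little to the total variation. The enumeration in
  the proof translates a tagged partial division into the indexed families of the definition.
\<close>
lemma abs_continuous_on_tagged_sum:
  fixes F :: "real \<Rightarrow> 'a::real_normed_vector"
  assumes "abs_continuous_on {a..b} F" and "e > 0"
  obtains d where "d > 0"
    and "\<And>B T. \<lbrakk>B tagged_partial_division_of {a..b}; \<And>t K. (t, K) \<in> B \<Longrightarrow> K \<subseteq> T;
              T \<in> lmeasurable; measure lebesgue T < d\<rbrakk>
            \<Longrightarrow> (\<Sum>(t, K)\<in>B. norm (F (Sup K) - F (Inf K))) < e"
proof -
  obtain d where "d > 0" and d: "\<And>(N::nat) l r. \<lbrakk>\<forall>k<N. l k \<le> r k \<and> {l k..r k} \<subseteq> {a..b};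
      disjoint_family_on (\<lambda>k. {l k<..<r k}) {..<N}; (\<Sum>k<N. r k - l k) < d\<rbrakk>
      \<Longrightarrow> (\<Sum>k<N. norm (F (r k) - F (l k))) < e"
    using assms unfolding abs_continuous_on_def by blast
  show thesis
  proof (rule that[OF \<open>d > 0\<close>])
    fix B T
    assume B: "B tagged_partial_division_of {a..b}" and T: "\<And>t K. (t, K) \<in> B \<Longrightarrow> K \<subseteq> T"
      and meas: "T \<in> lmeasurable" "measure lebesgue T < d"
    note BD = tagged_partial_division_ofD[OF B]
    obtain h where h: "bij_betw h {..<card B} B"
      using ex_bij_betw_nat_finite[OF BD(1)] by (auto simp: atLeast0LessThan)
    define l where "l k = Inf (snd (h k))" for k
    define r where "r k = Sup (snd (h k))" for k
    have K: "snd (h k) = {l k..r k}" "l k \<le> r k" "{l k..r k} \<subseteq> {a..b}" "{l k..r k} \<subseteq> T"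
      if "k < card B" for k
    proof -
      obtain t K where tK: "h k = (t, K)" by fastforce
      have "(t, K) \<in> B" using h that tK by (metis bij_betwE lessThan_iff)
      then obtain c c' where "K = {c..c'}" "t \<in> K" using BD(2,4) by (metis box_real(2))
      then have "l k = c" "r k = c'" "c \<le> c'" unfolding l_def r_def tK by auto
      then show "snd (h k) = {l k..r k}" "l k \<le> r k" "{l k..r k} \<subseteq> {a..b}" "{l k..r k} \<subseteq> T"
        using BD(3)[OF \<open>(t, K) \<in> B\<close>] T[OF \<open>(t, K) \<in> B\<close>] tK \<open>K = {c..c'}\<close> by auto
    qed
    have disj: "disjoint_family_on (\<lambda>k. {l k<..<r k}) {..<card B}"
      unfolding disjoint_family_on_def
    proof (intro ballI impI)
      fix j k
      assume jk: "j \<in> {..<card B}" "k \<in> {..<card B}" "j \<noteq> k"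
      then have "h j \<in> B" "h k \<in> B" "h j \<noteq> h k"
        using h by (auto simp: bij_betw_def inj_on_def)
      then have "interior (snd (h j)) \<inter> interior (snd (h k)) = {}"
        using BD(5) by (metis prod.collapse)
      then show "{l j<..<r j} \<inter> {l k<..<r k} = {}"
        using K(1) jk by (simp add: interior_atLeastAtMost_real)
    qed
    have "(\<Sum>k<card B. r k - l k) \<le> measure lebesgue T"
    proof (rule nonoverlapping_lengths_le_measure)
      fix k
      assume k: "k < card B"
      show "{l k<..<r k} \<subseteq> T" using K(4)[OF k] by force
    qed (use K disj meas in auto)
    then have "(\<Sum>k<card B. norm (F (r k) - F (l k))) < e"
      using K disj meas(2) by (intro d) auto
    also have "(\<Sum>k<card B. norm (F (r k) - F (l k)))
        = (\<Sum>p\<in>B. norm (F (Sup (snd p)) - F (Inf (snd p))))"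
      unfolding l_def r_def by (rule sum.reindex_bij_betw[OF h])
    finally show "(\<Sum>(t, K)\<in>B. norm (F (Sup K) - F (Inf K))) < e"
      by (simp add: case_prod_unfold)
  qed
qed

text \<open>
  An absolutely continuous function whose slopes over short intervals around almost every point
  are at most any given \<open>e > 0\<close> is nonincreasing. A gauge is chosen so that a tag in the null set
  \<open>N\<close> forces its interval into an open set of small measure, where absolute continuity
  bounds the increments, while any other tag makes its interval short enough for the slope bound.
  A division fine for this gauge splits \<open>\<Phi> b - \<Phi> a\<close> into these two kinds of increments. A
  slope condition is used in place of a derivative because minima of differentiable functions need
  not be differentiable where the minimizing index changes.
\<close>
lemma nonincreasing_if_straddle_ae:
  fixes \<Phi> :: "real \<Rightarrow> real"
  assumes "a \<le> b" and AC: "abs_continuous_on {a..b} \<Phi>" and N: "negligible N"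
    and straddle: "\<And>t e. \<lbrakk>t \<in> {a..b} - N; e > 0\<rbrakk> \<Longrightarrow>
      \<exists>d>0. \<forall>l r. a \<le> l \<longrightarrow> t - d < l \<longrightarrow> l \<le> t \<longrightarrow> t \<le> r \<longrightarrow> r < t + d \<longrightarrow> r \<le> b \<longrightarrow>
        \<Phi> r - \<Phi> l \<le> e * (r - l)"
  shows "\<Phi> b \<le> \<Phi> a"
proof -
  have "\<Phi> b - \<Phi> a \<le> e * (1 + (b - a))" if "e > 0" for e
  proof -
    obtain d where "d > 0" and d: "\<And>B T. \<lbrakk>B tagged_partial_division_of {a..b};
        \<And>t K. (t, K) \<in> B \<Longrightarrow> K \<subseteq> T; T \<in> lmeasurable; measure lebesgue T < d\<rbrakk>
        \<Longrightarrow> (\<Sum>(t, K)\<in>B. norm (\<Phi> (Sup K) - \<Phi> (Inf K))) < e"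
      using abs_continuous_on_tagged_sum[OF AC \<open>e > 0\<close>] by blast
    have "N \<in> sets lebesgue" using N by (simp add: negligible_iff_null_sets null_setsD2)
    then obtain T where T: "open T" "N \<subseteq> T" "T - N \<in> lmeasurable"
      and less: "emeasure lebesgue (T - N) < ennreal d"
      using sets_lebesgue_outer_open \<open>d > 0\<close> by blast
    have T_eq: "(T - N) \<union> N = T" using T(2) by blast
    have "T \<in> lmeasurable"
      using fmeasurable.Un[OF T(3) negligible_imp_measurable[OF N]] T_eq by simp
    have "measure lebesgue T = measure lebesgue (T - N)"
      using measure_Un_null_set[of "T - N" lebesgue N] T(3) N T_eq
      by (simp add: negligible_iff_null_sets fmeasurableD)
    then have "measure lebesgue T < d"
      using less emeasure_eq_measure2[OF T(3)] \<open>d > 0\<close> by (simp add: ennreal_less_iff)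
    obtain \<delta> where \<delta>: "\<And>t. t \<in> {a..b} - N \<Longrightarrow> \<delta> t > 0"
      "\<And>t l r. \<lbrakk>t \<in> {a..b} - N; a \<le> l; t - \<delta> t < l; l \<le> t; t \<le> r; r < t + \<delta> t; r \<le> b\<rbrakk>
        \<Longrightarrow> \<Phi> r - \<Phi> l \<le> e * (r - l)"
      using straddle[OF _ \<open>e > 0\<close>] by metis
    define \<gamma> where "\<gamma> t = (if t \<in> N then T else ball t (if t \<in> {a..b} then \<delta> t else 1))" for t
    have "gauge \<gamma>"
      unfolding gauge_def \<gamma>_def using T \<delta>(1) by auto
    then obtain p where p: "p tagged_division_of {a..b}" and fine: "\<gamma> fine p"
      using fine_division_exists_real by blast
    note pD = tagged_division_ofD[OF p]
    \<comment> \<open>\<open>B\<close> collects the intervals tagged in the null set.\<close>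
    define B where "B = {q \<in> p. fst q \<in> N}"
    have "finite p" "B \<subseteq> p" using pD(1) by (auto simp: B_def)
    have "B tagged_partial_division_of {a..b}"
      using p tagged_partial_division_subset[OF _ \<open>B \<subseteq> p\<close>] by (simp add: tagged_division_of_def)
    moreover have "K \<subseteq> T" if "(t, K) \<in> B" for t K
      using fineD[OF fine, of t K] that by (simp add: B_def \<gamma>_def)
    ultimately have "(\<Sum>(t, K)\<in>B. norm (\<Phi> (Sup K) - \<Phi> (Inf K))) < e"
      using d \<open>T \<in> lmeasurable\<close> \<open>measure lebesgue T < d\<close> by blast
    moreover have "(\<Sum>(t, K)\<in>B. \<Phi> (Sup K) - \<Phi> (Inf K))
        \<le> (\<Sum>(t, K)\<in>B. norm (\<Phi> (Sup K) - \<Phi> (Inf K)))"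
      by (intro sum_mono) auto
    ultimately have bad: "(\<Sum>(t, K)\<in>B. \<Phi> (Sup K) - \<Phi> (Inf K)) \<le> e" by linarith
    have interval: "\<exists>l r. K = {l..r} \<and> a \<le> l \<and> l \<le> t \<and> t \<le> r \<and> r \<le> b" if "(t, K) \<in> p" for t K
    proof -
      obtain l r where "K = {l..r}" using pD(4)[OF \<open>(t, K) \<in> p\<close>] by auto
      then show ?thesis using pD(2,3)[OF \<open>(t, K) \<in> p\<close>] by auto
    qed
    have good_one: "\<Phi> (Sup K) - \<Phi> (Inf K) \<le> e * (Sup K - Inf K)" if "(t, K) \<in> p - B" for t K
    proof -
      obtain l r where K: "K = {l..r}" "a \<le> l" "l \<le> t" "t \<le> r" "r \<le> b"
        using interval \<open>(t, K) \<in> p - B\<close> by blast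
      then have "t \<in> {a..b} - N" using \<open>(t, K) \<in> p - B\<close> by (auto simp: B_def)
      have "K \<subseteq> ball t (\<delta> t)"
        using fineD[OF fine, of t K] that \<open>t \<in> {a..b} - N\<close> by (simp add: \<gamma>_def)
      moreover have "l \<in> K" "r \<in> K" using K by auto
      ultimately have "l \<in> ball t (\<delta> t)" "r \<in> ball t (\<delta> t)" by blast+
      then have "t - \<delta> t < l" "r < t + \<delta> t" by (auto simp: dist_real_def)
      then show ?thesis using \<delta>(2)[of t l r] K \<open>t \<in> {a..b} - N\<close> by simp
    qed
    have "(\<Sum>(t, K)\<in>p - B. \<Phi> (Sup K) - \<Phi> (Inf K)) \<le> (\<Sum>(t, K)\<in>p - B. e * (Sup K - Inf K))"
      using good_one by (intro sum_mono) auto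
    also have "\<dots> \<le> (\<Sum>(t, K)\<in>p. e * (Sup K - Inf K))"
    proof (rule sum_mono2[OF \<open>finite p\<close>])
      fix q
      assume "q \<in> p - (p - B)"
      then show "0 \<le> (case q of (t, K) \<Rightarrow> e * (Sup K - Inf K))"
        using interval[of "fst q" "snd q"] \<open>e > 0\<close> by (auto simp: case_prod_unfold)
    qed auto
    also have "\<dots> = e * (b - a)"
      using additive_tagged_division_1[OF \<open>a \<le> b\<close> p, of "\<lambda>t. t"]
      by (simp add: case_prod_unfold sum_distrib_left[symmetric])
    finally have good: "(\<Sum>(t, K)\<in>p - B. \<Phi> (Sup K) - \<Phi> (Inf K)) \<le> e * (b - a)" .
    have "\<Phi> b - \<Phi> a = (\<Sum>(t, K)\<in>p. \<Phi> (Sup K) - \<Phi> (Inf K))"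
      using additive_tagged_division_1[OF \<open>a \<le> b\<close> p, of \<Phi>] by simp
    also have "\<dots> = (\<Sum>(t, K)\<in>p - B. \<Phi> (Sup K) - \<Phi> (Inf K)) + (\<Sum>(t, K)\<in>B. \<Phi> (Sup K) - \<Phi> (Inf K))"
      by (rule sum.subset_diff[OF \<open>B \<subseteq> p\<close> \<open>finite p\<close>])
    finally show ?thesis using bad good by (simp add: algebra_simps)
  qed
  note slope = this
  show ?thesis
  proof (rule field_le_epsilon)
    fix e :: real
    assume "e > 0"
    have "1 + (b - a) > 0" using \<open>a \<le> b\<close> by simp
    then have "e / (1 + (b - a)) > 0" "e / (1 + (b - a)) * (1 + (b - a)) = e"
      using \<open>e > 0\<close> by (auto simp del: add_diff_eq)
    then show "\<Phi> b \<le> \<Phi> a + e" using slope[of "e / (1 + (b - a))"] by simp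
  qed
qed

lemma straddle_if_derivative_nonpos:
  fixes u :: "real \<Rightarrow> real"
  assumes "(u has_field_derivative D) (at t within S)" and "D \<le> 0" and "e > 0"
  shows "\<exists>d>0. \<forall>l\<in>S. \<forall>r\<in>S. t - d < l \<longrightarrow> l \<le> t \<longrightarrow> t \<le> r \<longrightarrow> r < t + d \<longrightarrow> u r - u l \<le> e * (r - l)"
proof -
  obtain d where "d > 0" and d: "\<And>s. \<lbrakk>s \<in> S; \<bar>s - t\<bar> < d\<rbrakk> \<Longrightarrow> \<bar>u s - u t - D * (s - t)\<bar> \<le> e * \<bar>s - t\<bar>"
    using assms(1,3) unfolding has_field_derivative_def has_derivative_within_alt by (auto simp: algebra_simps)
  have "u r - u l \<le> e * (r - l)"
    if "l \<in> S" "r \<in> S" "t - d < l" "l \<le> t" "t \<le> r" "r < t + d" for l r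
  proof -
    have "\<bar>u l - u t - D * (l - t)\<bar> \<le> e * \<bar>l - t\<bar>" "\<bar>u r - u t - D * (r - t)\<bar> \<le> e * \<bar>r - t\<bar>"
      using d[of l] d[of r] that by (simp_all add: abs_if)
    then have "u r - u l \<le> (D + e) * (r - l)"
      using that by (auto simp: abs_if algebra_simps split: if_splits)
    also have "\<dots> \<le> e * (r - l)" using that assms(2) by (intro mult_right_mono) auto
    finally show ?thesis .
  qed
  then show ?thesis using \<open>d > 0\<close> by blast
qed

text \<open>
  For a pointwise minimum it suffices to control the derivatives of the active members, that is,
  those attaining the minimum at the point in question. Indeed, with an index \<open>i\<close> active at
  the left end \<open>l\<close> of an interval \<open>[l, r]\<close> around \<open>t\<close>, the increment of the minimum
  is at most \<open>\<phi> i r - \<phi> i l\<close>; and by continuity an index that is active at points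
  \<open>l\<close> arbitrarily close to \<open>t\<close> is active at \<open>t\<close>.
\<close>
lemma min_family_nonincreasing:
  fixes \<phi> :: "'i::finite \<Rightarrow> real \<Rightarrow> real"
  assumes "a \<le> b" and AC: "\<And>i. abs_continuous_on {a..b} (\<phi> i)"
    and cont: "\<And>i. continuous_on {a..b} (\<phi> i)"
    and deriv: "AE t in lebesgue. t \<in> {a..b} \<longrightarrow>
      (\<forall>i. (\<forall>j. \<phi> i t \<le> \<phi> j t) \<longrightarrow> (\<exists>D\<le>0. (\<phi> i has_field_derivative D) (at t within {a..b})))"
  shows "(MIN i. \<phi> i b) \<le> (MIN i. \<phi> i a)"
proof -
  define \<Phi> where "\<Phi> t = (MIN i. \<phi> i t)" for t
  from deriv obtain N where N: "N \<in> null_sets lebesgue" and off_N: "\<And>t. t \<notin> N \<Longrightarrow> t \<in> {a..b} \<longrightarrow>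
      (\<forall>i. (\<forall>j. \<phi> i t \<le> \<phi> j t) \<longrightarrow> (\<exists>D\<le>0. (\<phi> i has_field_derivative D) (at t within {a..b})))"
    by (rule AE_E3) auto
  have der: "\<exists>D\<le>0. (\<phi> i has_field_derivative D) (at t within {a..b})"
    if "t \<in> {a..b} - N" "\<forall>j. \<phi> i t \<le> \<phi> j t" for t i
    using off_N[of t] that by blast
  have \<Phi>_le: "\<Phi> t \<le> \<phi> i t" for i t unfolding \<Phi>_def by simp
  have \<Phi>_attained: "\<exists>i. \<phi> i t = \<Phi> t" for t
    unfolding \<Phi>_def using Min_in[of "range (\<lambda>i. \<phi> i t)"] by fastforce
  \<comment> \<open>The slope bound of each member is needed only when it is active at the left end.\<close>
  have each: "\<exists>d>0. \<forall>l\<in>{a..b}. \<forall>r\<in>{a..b}. t - d < l \<longrightarrow> l \<le> t \<longrightarrow> t \<le> r \<longrightarrow> r < t + d \<longrightarrow>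
      \<phi> i l = \<Phi> l \<longrightarrow> \<phi> i r - \<phi> i l \<le> e * (r - l)"
    if t: "t \<in> {a..b} - N" and "e > 0" for t e i
  proof (cases "\<forall>j. \<phi> i t \<le> \<phi> j t")
    case True
    then obtain D where "D \<le> 0" "(\<phi> i has_field_derivative D) (at t within {a..b})"
      using der[OF t] by blast
    from straddle_if_derivative_nonpos[OF this(2,1) \<open>e > 0\<close>] show ?thesis by blast
  next
    case False
    then obtain j where "\<phi> j t < \<phi> i t" by (auto simp: not_le)
    have "((\<lambda>s. \<phi> i s - \<phi> j s) \<longlongrightarrow> \<phi> i t - \<phi> j t) (at t within {a..b})"
      using cont[of i] cont[of j] t unfolding continuous_on_def by (intro tendsto_diff) auto
    then have "\<forall>\<^sub>F s in at t within {a..b}. \<phi> i s - \<phi> j s > 0"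
      using \<open>\<phi> j t < \<phi> i t\<close> by (intro order_tendstoD(1)) auto
    then obtain d where "d > 0" and d: "\<And>s. \<lbrakk>s \<in> {a..b}; s \<noteq> t; dist s t < d\<rbrakk> \<Longrightarrow> \<phi> i s - \<phi> j s > 0"
      unfolding eventually_at by auto
    \<comment> \<open>An index that is inactive at \<open>t\<close> stays inactive nearby, so nothing is to be shown.\<close>
    have inactive: "\<phi> i l \<noteq> \<Phi> l" if "l \<in> {a..b}" "t - d < l" "l \<le> t" for l
    proof -
      have "\<phi> j l < \<phi> i l"
        using d[of l] that \<open>\<phi> j t < \<phi> i t\<close> by (cases "l = t") (auto simp: dist_real_def)
      then show ?thesis using \<Phi>_le[of l j] by auto
    qed
    then show ?thesis using \<open>d > 0\<close> by blast
  qed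
  have "\<Phi> b \<le> \<Phi> a"
  proof (rule nonincreasing_if_straddle_ae[OF \<open>a \<le> b\<close>])
    show "abs_continuous_on {a..b} \<Phi>"
      unfolding \<Phi>_def using AC by (intro abs_continuous_on_Min) auto
    show "negligible N" using N by (simp add: negligible_iff_null_sets)
    fix t e :: real
    assume "t \<in> {a..b} - N" "e > 0"
    then obtain \<delta> where \<delta>: "\<And>i. \<delta> i > 0"
      "\<And>i l r. \<lbrakk>l \<in> {a..b}; r \<in> {a..b}; t - \<delta> i < l; l \<le> t; t \<le> r; r < t + \<delta> i; \<phi> i l = \<Phi> l\<rbrakk>
        \<Longrightarrow> \<phi> i r - \<phi> i l \<le> e * (r - l)"
      using each by metis
    define d where "d = (MIN i. \<delta> i)"
    have "d > 0" unfolding d_def using \<delta>(1) by auto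
    have d_le: "d \<le> \<delta> i" for i unfolding d_def by simp
    have "\<Phi> r - \<Phi> l \<le> e * (r - l)"
      if "a \<le> l" "t - d < l" "l \<le> t" "t \<le> r" "r < t + d" "r \<le> b" for l r
    proof -
      obtain i where i: "\<phi> i l = \<Phi> l" using \<Phi>_attained by blast
      have "\<phi> i r - \<phi> i l \<le> e * (r - l)"
        using that i d_le[of i] by (intro \<delta>(2)) auto
      then show ?thesis using \<Phi>_le[of r i] i by linarith
    qed
    then show "\<exists>d>0. \<forall>l r. a \<le> l \<longrightarrow> t - d < l \<longrightarrow> l \<le> t \<longrightarrow> t \<le> r \<longrightarrow> r < t + d \<longrightarrow> r \<le> b \<longrightarrow>
        \<Phi> r - \<Phi> l \<le> e * (r - l)"
      using \<open>d > 0\<close> by blast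
  qed
  then show ?thesis by (simp add: \<Phi>_def)
qed

section \<open>Convexity and the projection equation\<close>
lemma convex_gradient_inequality:
  assumes "convex_on UNIV f" and "GDERIV f y :> d"
  shows "f y - f z \<le> d \<bullet> (y - z)"
proof -
  define p where "p s = y + s *\<^sub>R (z - y)" for s :: real
  have "convex_on UNIV (\<lambda>s. f (p s))"
  proof (intro convex_onI)
    fix c s s' :: real
    assume "0 < c" "c < 1"
    have "p ((1 - c) *\<^sub>R s + c *\<^sub>R s') = (1 - c) *\<^sub>R p s + c *\<^sub>R p s'"
      by (simp add: p_def algebra_simps)
    then show "f (p ((1 - c) *\<^sub>R s + c *\<^sub>R s')) \<le> (1 - c) * f (p s) + c * f (p s')"
      using convex_onD[OF assms(1), of c "p s" "p s'"] \<open>0 < c\<close> \<open>c < 1\<close> by simp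
  qed simp
  moreover have "((\<lambda>s. f (p s)) has_field_derivative d \<bullet> (z - y)) (at 0)"
  proof -
    have f: "(f has_derivative (\<lambda>h. h \<bullet> d)) (at (p 0))"
      using assms(2) by (simp add: gderiv_def p_def)
    have "(p has_derivative (\<lambda>s. s *\<^sub>R (z - y))) (at 0)"
      unfolding p_def by (auto intro!: derivative_eq_intros)
    from has_derivative_compose[OF this f]
    have "((\<lambda>s. f (p s)) has_derivative (\<lambda>s. (s *\<^sub>R (z - y)) \<bullet> d)) (at 0)" .
    moreover have "(\<lambda>s. (s *\<^sub>R (z - y)) \<bullet> d) = (*) (d \<bullet> (z - y))"
      by (simp add: fun_eq_iff inner_commute[of d])
    ultimately show ?thesis by (simp only: has_field_derivative_def)
  qed
  ultimately have "d \<bullet> (z - y) * (1 - 0) \<le> f (p 1) - f (p 0)"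
    by (intro convex_on_imp_above_tangent[where A = UNIV]) auto
  then show ?thesis by (simp add: p_def inner_diff_right)
qed

lemma convex_hull_gradient_gap:
  fixes g :: "'m::finite \<Rightarrow> real ^ 'n \<Rightarrow> real ^ 'n"
  assumes "\<xi> \<in> gradient_hull g y" and "\<And>i. c \<le> g i y \<bullet> w"
  shows "c \<le> \<xi> \<bullet> w"
proof -
  have "gradient_hull g y \<subseteq> {\<eta>. w \<bullet> \<eta> \<ge> c}"
    unfolding gradient_hull_def using assms(2)
    by (intro hull_minimal convex_halfspace_ge) (auto simp: inner_commute)
  then show ?thesis using assms(1) by (auto simp: inner_commute)
qed

text \<open>
  The equation says that \<open>- c v\<close> is the projection of \<open>0\<close> onto the translated hull. Being
  a member of that set, it yields the force \<open>\<xi> = - (a + c v)\<close> in the hull itself; the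
  variational inequality of the projection says that along \<open>v\<close> no gradient
  has a larger component than \<open>\<xi>\<close>.
\<close>
lemma projection_velocity_inequality:
  fixes g :: "'m::finite \<Rightarrow> real ^ 'n \<Rightarrow> real ^ 'n"
  assumes "c > 0" and "c *\<^sub>R v + closest_point ((\<lambda>\<xi>. \<xi> + a) ` gradient_hull g y) 0 = 0"
  shows "- (a + c *\<^sub>R v) \<in> gradient_hull g y"
    and "g i y \<bullet> v \<le> - (a + c *\<^sub>R v) \<bullet> v"
proof -
  let ?C = "(\<lambda>\<xi>. \<xi> + a) ` gradient_hull g y"
  have "compact (gradient_hull g y)" unfolding gradient_hull_def
    by (intro finite_imp_compact_convex_hull) simp
  have img: "?C = (\<lambda>\<xi>. a + \<xi>) ` gradient_hull g y" by (simp add: add.commute)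
  have "compact ?C" unfolding img by (rule compact_translation) fact
  then have "closed ?C" by (rule compact_imp_closed)
  have "convex ?C" unfolding img by (rule convex_translation) (simp add: gradient_hull_def)
  have gi: "g i y \<in> gradient_hull g y" for i
    unfolding gradient_hull_def by (intro hull_inc) auto
  then have "?C \<noteq> {}" by auto
  have p: "closest_point ?C 0 = - (c *\<^sub>R v)"
    using assms(2) by (simp add: eq_neg_iff_add_eq_0 add.commute)
  have "- (c *\<^sub>R v) \<in> ?C"
    using closest_point_in_set[OF \<open>closed ?C\<close> \<open>?C \<noteq> {}\<close>, of 0] p by simp
  then obtain \<xi> where \<xi>: "\<xi> \<in> gradient_hull g y" "- (c *\<^sub>R v) = \<xi> + a" by blast
  have "- (a + c *\<^sub>R v) = - (c *\<^sub>R v) - a" by simp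
  also have "\<dots> = \<xi>" unfolding \<xi>(2) by simp
  finally show "- (a + c *\<^sub>R v) \<in> gradient_hull g y" using \<xi>(1) by (simp only:)
  have "(0 - closest_point ?C 0) \<bullet> ((g i y + a) - closest_point ?C 0) \<le> 0"
    using gi by (intro closest_point_dot \<open>convex ?C\<close> \<open>closed ?C\<close>) auto
  then have "c * (v \<bullet> (g i y + a + c *\<^sub>R v)) \<le> 0" unfolding p by simp
  then have "v \<bullet> (g i y + a + c *\<^sub>R v) \<le> 0" using \<open>c > 0\<close> by (simp add: mult_le_0_iff)
  then show "g i y \<bullet> v \<le> - (a + c *\<^sub>R v) \<bullet> v"
    by (simp add: inner_add_right inner_diff_right inner_commute)
qed

text \<open>
  The two consequences of the projection equation that the energy estimates need, with the velocity
  made explicit. The vector \<open>- (a + (\<alpha> / t) v)\<close> is the convex combination of gradients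
  that acts as the force at time \<open>t\<close>.
\<close>
definition velocity_solution ::
  "real \<Rightarrow> ('m::finite \<Rightarrow> real ^ 'n \<Rightarrow> real ^ 'n) \<Rightarrow> (real \<Rightarrow> real ^ 'n) \<Rightarrow> (real \<Rightarrow> real ^ 'n) \<Rightarrow> bool" where
  "velocity_solution \<alpha> g x v \<longleftrightarrow>
    (\<forall>t\<ge>1. (x has_vector_derivative v t) (at t within {1..})) \<and>
    continuous_on {1..} v \<and>
    (\<forall>b. abs_continuous_on {1..b} v) \<and>
    (AE t in lebesgue. 1 \<le> t \<longrightarrow>
      (\<exists>a. (v has_vector_derivative a) (at t within {1..}) \<and>
           - (a + (\<alpha> / t) *\<^sub>R v t) \<in> gradient_hull g (x t) \<and>
           (\<forall>i. g i (x t) \<bullet> v t \<le> - (a + (\<alpha> / t) *\<^sub>R v t) \<bullet> v t)))"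

lemma cauchy_solution_velocity:
  assumes "cauchy_solution \<alpha> g x0 x" and "\<alpha> > 0"
  obtains v where "velocity_solution \<alpha> g x v" and "v 1 = 0"
proof -
  from assms(1) obtain v where x: "\<forall>t\<ge>1. (x has_vector_derivative v t) (at t within {1..})"
    and v: "continuous_on {1..} v" "\<And>a b. \<lbrakk>1 \<le> a; a \<le> b\<rbrakk> \<Longrightarrow> abs_continuous_on {a..b} v" "v 1 = 0"
    and ode: "AE t in lebesgue. 1 \<le> t \<longrightarrow>
            (\<exists>a. (v has_vector_derivative a) (at t within {1..}) \<and>
                 (\<alpha> / t) *\<^sub>R v t + closest_point ((\<lambda>\<xi>. \<xi> + a) ` gradient_hull g (x t)) 0 = 0)"
    unfolding cauchy_solution_def by blast
  have "abs_continuous_on {1..b} v" for b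
    using v(2)[of 1 "max 1 b"] by (rule abs_continuous_on_subset) auto
  moreover have "AE t in lebesgue. 1 \<le> t \<longrightarrow>
      (\<exists>a. (v has_vector_derivative a) (at t within {1..}) \<and>
           - (a + (\<alpha> / t) *\<^sub>R v t) \<in> gradient_hull g (x t) \<and>
           (\<forall>i. g i (x t) \<bullet> v t \<le> - (a + (\<alpha> / t) *\<^sub>R v t) \<bullet> v t))"
    using ode
  proof (eventually_elim, intro impI)
    fix t :: real
    assume "1 \<le> t \<longrightarrow> (\<exists>a. (v has_vector_derivative a) (at t within {1..}) \<and>
                 (\<alpha> / t) *\<^sub>R v t + closest_point ((\<lambda>\<xi>. \<xi> + a) ` gradient_hull g (x t)) 0 = 0)"
      and "1 \<le> t"
    then obtain a where "(v has_vector_derivative a) (at t within {1..})"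
      and "(\<alpha> / t) *\<^sub>R v t + closest_point ((\<lambda>\<xi>. \<xi> + a) ` gradient_hull g (x t)) 0 = 0" by blast
    then show "\<exists>a. (v has_vector_derivative a) (at t within {1..}) \<and>
           - (a + (\<alpha> / t) *\<^sub>R v t) \<in> gradient_hull g (x t) \<and>
           (\<forall>i. g i (x t) \<bullet> v t \<le> - (a + (\<alpha> / t) *\<^sub>R v t) \<bullet> v t)"
      using projection_velocity_inequality[of "\<alpha> / t"] \<open>1 \<le> t\<close> \<open>\<alpha> > 0\<close> by (intro exI[of _ a]) auto
  qed
  ultimately have "velocity_solution \<alpha> g x v"
    using x v(1) unfolding velocity_solution_def by blast
  then show thesis using that v(3) by blast
qed

section \<open>Energy estimates along a trajectory\<close>
context
  fixes f :: "'m::finite \<Rightarrow> real ^ 'n \<Rightarrow> real" and g :: "'m \<Rightarrow> real ^ 'n \<Rightarrow> real ^ 'n"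
    and \<alpha> :: real and x v :: "real \<Rightarrow> real ^ 'n"
  assumes gradient: "\<And>i y. GDERIV (f i) y :> g i y"
    and gradient_continuous: "\<And>i. continuous_on UNIV (g i)"
    and solution: "velocity_solution \<alpha> g x v"
begin

lemma position_derivative:
  assumes "t \<in> {1..b}"
  shows "(x has_vector_derivative v t) (at t within {1..b})"
proof (rule has_vector_derivative_within_subset)
  show "(x has_vector_derivative v t) (at t within {1..})"
    using assms solution unfolding velocity_solution_def by simp
qed auto

lemma velocity_continuous: "continuous_on {1..b} v"
  using solution unfolding velocity_solution_def by (auto elim: continuous_on_subset)

lemma velocity_abs_continuous: "abs_continuous_on {1..b} v"
  using solution unfolding velocity_solution_def by blast

lemma position_continuous: "continuous_on {1..b} x"
  using position_derivative by (rule continuous_on_vector_derivative)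

lemma objective_derivative:
  assumes "t \<in> {1..b}"
  shows "((\<lambda>t. f i (x t)) has_field_derivative g i (x t) \<bullet> v t) (at t within {1..b})"
proof -
  have "(f i has_derivative (\<lambda>h. h \<bullet> g i (x t))) (at (x t))"
    using gradient by (simp add: gderiv_def)
  then have "((\<lambda>t. f i (x t)) has_derivative (\<lambda>s. (s *\<^sub>R v t) \<bullet> g i (x t))) (at t within {1..b})"
    using position_derivative[OF assms] unfolding has_vector_derivative_def
    by (rule has_derivative_compose[rotated])
  moreover have "(\<lambda>s. (s *\<^sub>R v t) \<bullet> g i (x t)) = (*) (g i (x t) \<bullet> v t)"
    by (simp add: fun_eq_iff inner_commute[of "g i (x t)"])
  ultimately show ?thesis by (simp only: has_field_derivative_def)
qed

lemma objective_continuous: "continuous_on {1..b} (\<lambda>t. f i (x t))"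
  using objective_derivative by (rule DERIV_continuous_on)

lemma objective_abs_continuous: "abs_continuous_on {1..b} (\<lambda>t. f i (x t))"
proof (rule abs_continuous_on_C1)
  show "((\<lambda>t. f i (x t)) has_vector_derivative g i (x t) \<bullet> v t) (at t within {1..b})"
    if "t \<in> {1..b}" for t
    using objective_derivative[OF that] by (simp add: has_real_derivative_iff_has_vector_derivative)
  have "continuous_on {1..b} (\<lambda>t. g i (x t))"
    using gradient_continuous position_continuous by (rule continuous_on_compose2) auto
  then show "continuous_on {1..b} (\<lambda>t. g i (x t) \<bullet> v t)"
    using velocity_continuous by (intro continuous_on_inner)
qed

lemma force_in_gradient_hull_ae:
  "AE t in lebesgue. t \<in> {1..b} \<longrightarrow>
    (\<exists>a. (v has_vector_derivative a) (at t within {1..b}) \<and>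
         - (a + (\<alpha> / t) *\<^sub>R v t) \<in> gradient_hull g (x t) \<and>
         (\<forall>i. g i (x t) \<bullet> v t \<le> - (a + (\<alpha> / t) *\<^sub>R v t) \<bullet> v t))"
proof -
  have sub: "(v has_vector_derivative a) (at t within {1..b})"
    if "(v has_vector_derivative a) (at t within {1..})" for a t
    using that by (rule has_vector_derivative_within_subset) auto
  have "AE t in lebesgue. 1 \<le> t \<longrightarrow>
      (\<exists>a. (v has_vector_derivative a) (at t within {1..}) \<and>
           - (a + (\<alpha> / t) *\<^sub>R v t) \<in> gradient_hull g (x t) \<and>
           (\<forall>i. g i (x t) \<bullet> v t \<le> - (a + (\<alpha> / t) *\<^sub>R v t) \<bullet> v t))"
    using solution unfolding velocity_solution_def by blast
  then show ?thesis
  proof (eventually_elim, intro impI)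
    fix t
    assume "1 \<le> t \<longrightarrow> (\<exists>a. (v has_vector_derivative a) (at t within {1..}) \<and>
           - (a + (\<alpha> / t) *\<^sub>R v t) \<in> gradient_hull g (x t) \<and>
           (\<forall>i. g i (x t) \<bullet> v t \<le> - (a + (\<alpha> / t) *\<^sub>R v t) \<bullet> v t))"
      and "t \<in> {1..b}"
    then obtain a where "(v has_vector_derivative a) (at t within {1..})"
      and a: "- (a + (\<alpha> / t) *\<^sub>R v t) \<in> gradient_hull g (x t)"
        "\<forall>i. g i (x t) \<bullet> v t \<le> - (a + (\<alpha> / t) *\<^sub>R v t) \<bullet> v t" by auto
    then have "(v has_vector_derivative a) (at t within {1..b})" by (intro sub)
    with a show "\<exists>a. (v has_vector_derivative a) (at t within {1..b}) \<and>
         - (a + (\<alpha> / t) *\<^sub>R v t) \<in> gradient_hull g (x t) \<and>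
         (\<forall>i. g i (x t) \<bullet> v t \<le> - (a + (\<alpha> / t) *\<^sub>R v t) \<bullet> v t)" by blast
  qed
qed

text \<open>
  The derivative of the potential energy \<open>f i (x t)\<close> is at most the power of the force, so that
  friction dissipates the mechanical energy of every objective separately. A trajectory starting
  at rest is thereby kept in the level set of its starting point.
\<close>
lemma mechanical_energy_nonincreasing:
  assumes "\<alpha> \<ge> 0" and "1 \<le> T"
  shows "f i (x T) + (v T \<bullet> v T) / 2 \<le> f i (x 1) + (v 1 \<bullet> v 1) / 2"
proof -
  define W where "W t = f i (x t) + (1/2) * (v t \<bullet> v t)" for t
  have cont: "continuous_on {1..T} W"
    unfolding W_def by (intro continuous_intros objective_continuous velocity_continuous)
  have AC: "abs_continuous_on {1..T} W"
    unfolding W_def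
    by (intro abs_continuous_on_add objective_abs_continuous
        bounded_bilinear.abs_continuous_on[OF bounded_bilinear_mult]
        bounded_bilinear.abs_continuous_on[OF bounded_bilinear_inner]
        velocity_abs_continuous velocity_continuous continuous_intros
        abs_continuous_on_C1[of _ _ "\<lambda>_. 1/2" "\<lambda>_. 0"] has_vector_derivative_const)
  have "AE t in lebesgue. t \<in> {1..T} \<longrightarrow> (\<exists>D\<le>0. (W has_field_derivative D) (at t within {1..T}))"
    using force_in_gradient_hull_ae[of T]
  proof (eventually_elim, intro impI)
    fix t
    assume "t \<in> {1..T} \<longrightarrow> (\<exists>a. (v has_vector_derivative a) (at t within {1..T}) \<and>
           - (a + (\<alpha> / t) *\<^sub>R v t) \<in> gradient_hull g (x t) \<and>
           (\<forall>i. g i (x t) \<bullet> v t \<le> - (a + (\<alpha> / t) *\<^sub>R v t) \<bullet> v t))"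
      and t: "t \<in> {1..T}"
    then obtain a where a: "(v has_vector_derivative a) (at t within {1..T})"
      and le: "\<And>i. g i (x t) \<bullet> v t \<le> - (a + (\<alpha> / t) *\<^sub>R v t) \<bullet> v t" by blast
    have "(W has_field_derivative g i (x t) \<bullet> v t + a \<bullet> v t) (at t within {1..T})"
      using objective_derivative[OF t, of i] a
      unfolding W_def has_field_derivative_def has_vector_derivative_def
      by (auto intro!: derivative_eq_intros simp: fun_eq_iff inner_commute algebra_simps)
    moreover have "g i (x t) \<bullet> v t + a \<bullet> v t \<le> - (\<alpha> / t) * (v t \<bullet> v t)"
      using le[of i] by (simp add: inner_diff_left)
    moreover have "(\<alpha> / t) * (v t \<bullet> v t) \<ge> 0" using t \<open>\<alpha> \<ge> 0\<close> by auto
    ultimately show "\<exists>D\<le>0. (W has_field_derivative D) (at t within {1..T})"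
      by (intro exI[of _ "g i (x t) \<bullet> v t + a \<bullet> v t"]) auto
  qed
  then have "(MIN _::unit. W T) \<le> (MIN _::unit. W 1)"
    using min_family_nonincreasing[of 1 T "\<lambda>_::unit. W"] \<open>1 \<le> T\<close> AC cont by auto
  then show ?thesis by (simp add: W_def)
qed

text \<open>
  The value 3 of the damping parameter makes
  \<open>2 (x - z) + t v\<close> have derivative \<open>3 v + t a = - t \<xi>\<close>, where \<open>\<xi>\<close> is
  the force. Hence the derivative of \<open>E i\<close> is
  \<open>2 t (f i x - f i z - \<xi> \<bullet> (x - z)) + t\<^sup>2 (g i x \<bullet> v - \<xi> \<bullet> v)\<close>.
  The second term is nonpositive for every \<open>i\<close> by the projection inequality. The first one is
  so when \<open>i\<close> is active: then \<open>f i x - f i z\<close> is the smallest of the gaps, each of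
  which is at most \<open>g j x \<bullet> (x - z)\<close> by convexity, and \<open>\<xi>\<close> is a convex combination of
  the \<open>g j x\<close>. This is why the minimum, and not each \<open>E i\<close>, decreases.
\<close>
lemma lyapunov_nonincreasing:
  fixes z :: "real ^ 'n"
  assumes "\<alpha> = 3" and convex: "\<And>i. convex_on UNIV (f i)" and "1 \<le> T"
  defines "E i t \<equiv> t\<^sup>2 * (f i (x t) - f i z) + (norm (2 *\<^sub>R (x t - z) + t *\<^sub>R v t))\<^sup>2 / 2"
  shows "(MIN i. E i T) \<le> (MIN i. E i 1)"
proof -
  \<comment> \<open>Written as a sum of products so that the product rules apply directly.\<close>
  define w where "w t = 2 *\<^sub>R x t + t *\<^sub>R v t + (- 2) *\<^sub>R z" for t
  have E_eq: "E i t = t * t * (f i (x t) + - f i z) + (1/2) * (w t \<bullet> w t)" for i t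
  proof -
    have "2 *\<^sub>R (x t - z) + t *\<^sub>R v t = w t" by (simp add: w_def algebra_simps)
    then show ?thesis by (simp add: E_def dot_square_norm power2_eq_square)
  qed
  have w_cont: "continuous_on {1..T} w"
    unfolding w_def by (intro continuous_intros position_continuous velocity_continuous)
  have const: "abs_continuous_on {1..T} (\<lambda>_. c)" for c :: "'b::real_normed_vector"
    by (rule abs_continuous_on_C1[where u' = "\<lambda>_. 0"]) (auto intro!: has_vector_derivative_const)
  have x_AC: "abs_continuous_on {1..T} x"
    using position_derivative velocity_continuous by (rule abs_continuous_on_C1)
  have w_AC: "abs_continuous_on {1..T} w"
    unfolding w_def
    by (intro abs_continuous_on_add const x_AC abs_continuous_on_ident
        bounded_bilinear.abs_continuous_on[OF bounded_bilinear_scaleR]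
        velocity_abs_continuous velocity_continuous position_continuous continuous_intros)
  show ?thesis
  proof (rule min_family_nonincreasing[OF \<open>1 \<le> T\<close>])
    fix i
    show "continuous_on {1..T} (E i)"
      unfolding E_eq[abs_def] by (intro continuous_intros objective_continuous w_cont)
    show "abs_continuous_on {1..T} (E i)"
      unfolding E_eq[abs_def]
      by (intro abs_continuous_on_add const objective_abs_continuous abs_continuous_on_ident w_AC
          bounded_bilinear.abs_continuous_on[OF bounded_bilinear_mult]
          bounded_bilinear.abs_continuous_on[OF bounded_bilinear_inner]
          w_cont objective_continuous continuous_intros)
  next
    show "AE t in lebesgue. t \<in> {1..T} \<longrightarrow>
      (\<forall>i. (\<forall>j. E i t \<le> E j t) \<longrightarrow> (\<exists>D\<le>0. (E i has_field_derivative D) (at t within {1..T})))"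
      using force_in_gradient_hull_ae[of T]
    proof (eventually_elim, intro impI allI)
      fix t i
      assume "t \<in> {1..T} \<longrightarrow> (\<exists>a. (v has_vector_derivative a) (at t within {1..T}) \<and>
             - (a + (\<alpha> / t) *\<^sub>R v t) \<in> gradient_hull g (x t) \<and>
             (\<forall>i. g i (x t) \<bullet> v t \<le> - (a + (\<alpha> / t) *\<^sub>R v t) \<bullet> v t))"
        and t: "t \<in> {1..T}" and active: "\<forall>j. E i t \<le> E j t"
      then obtain a where a: "(v has_vector_derivative a) (at t within {1..T})"
        and hull: "- (a + (\<alpha> / t) *\<^sub>R v t) \<in> gradient_hull g (x t)"
        and le: "\<And>i. g i (x t) \<bullet> v t \<le> - (a + (\<alpha> / t) *\<^sub>R v t) \<bullet> v t" by blast
      define \<xi> where "\<xi> = - (a + (\<alpha> / t) *\<^sub>R v t)"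
      have "t > 0" using t by auto
      have w': "3 *\<^sub>R v t + t *\<^sub>R a = - t *\<^sub>R \<xi>"
        using \<open>t > 0\<close> \<open>\<alpha> = 3\<close> by (simp add: \<xi>_def algebra_simps)
      have "(w has_derivative (\<lambda>s. s *\<^sub>R (3 *\<^sub>R v t + t *\<^sub>R a))) (at t within {1..T})"
        using position_derivative[OF t] a unfolding w_def has_vector_derivative_def
        by (auto intro!: derivative_eq_intros simp: fun_eq_iff algebra_simps
            simp flip: scaleR_add_left)
      then have "(w has_derivative (\<lambda>s. s *\<^sub>R (- t *\<^sub>R \<xi>))) (at t within {1..T})"
        unfolding w' .
      then have "(E i has_field_derivative 2 * t * (f i (x t) - f i z)
          + t\<^sup>2 * (g i (x t) \<bullet> v t) + - t * (\<xi> \<bullet> w t)) (at t within {1..T})"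
        using objective_derivative[OF t, of i]
        unfolding E_eq[abs_def] has_field_derivative_def
        by (auto intro!: derivative_eq_intros
            simp: fun_eq_iff inner_commute algebra_simps power2_eq_square)
      moreover have "2 * t * (f i (x t) - f i z) + t\<^sup>2 * (g i (x t) \<bullet> v t) + - t * (\<xi> \<bullet> w t) \<le> 0"
      proof -
        have "t * t * (f i (x t)  - f i z) \<le> t * t * (f j (x t) - f j z)" for j
          using active[rule_format, of j] by (simp add: E_eq)
        then have "f i (x t) - f i z \<le> f j (x t) - f j z" for j
          using \<open>t > 0\<close> by (simp add: mult_le_cancel_left_pos)
        then have "f i (x t) - f i z \<le> g j (x t) \<bullet> (x t - z)" for j
          using convex_gradient_inequality[OF convex gradient] order_trans by blast
        then have "f i (x t) - f i z \<le> \<xi> \<bullet> (x t - z)"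
          unfolding \<xi>_def using hull by (rule convex_hull_gradient_gap[rotated])
        then have "2 * t * (f i (x t) - f i z) \<le> 2 * t * (\<xi> \<bullet> (x t - z))"
          using \<open>t > 0\<close> by (intro mult_left_mono) auto
        moreover have "t\<^sup>2 * (g i (x t) \<bullet> v t) \<le> t\<^sup>2 * (\<xi> \<bullet> v t)"
          unfolding \<xi>_def by (intro mult_left_mono le) auto
        moreover have "t * (\<xi> \<bullet> w t) = 2 * t * (\<xi> \<bullet> (x t - z)) + t\<^sup>2 * (\<xi> \<bullet> v t)"
          by (simp add: w_def inner_add_right inner_diff_right algebra_simps power2_eq_square)
        ultimately show ?thesis by linarith
      qed
      ultimately show "\<exists>D\<le>0. (E i has_field_derivative D) (at t within {1..T})" by blast
    qed
  qed
qed

end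

section \<open>Limit points of the trajectory\<close>
lemma converges_to_set_if_limit_points:
  fixes x :: "real \<Rightarrow> 'a::heine_borel"
  assumes bdd: "bounded (x ` {c..})"
    and limit: "\<And>s p. \<lbrakk>\<And>k::nat. s k \<ge> c; filterlim s at_top sequentially; (\<lambda>k. x (s k)) \<longlonglongrightarrow> p\<rbrakk>
                  \<Longrightarrow> p \<in> S"
  shows "converges_to_set x S"
proof -
  have cluster: "\<exists>p r. p \<in> S \<and> strict_mono r \<and> (\<lambda>k. x (s (r k))) \<longlonglongrightarrow> p"
    if s: "\<And>k::nat. s k \<ge> c" "filterlim s at_top sequentially" for s
  proof -
    have "bounded (range (\<lambda>k. x (s k)))"
      using bdd by (rule bounded_subset) (use s(1) in auto)
    then obtain p r where r: "strict_mono r" and p: "((\<lambda>k. x (s k)) \<circ> r) \<longlonglongrightarrow> p"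
      using bounded_imp_convergent_subsequence by blast
    have "filterlim (\<lambda>k. s (r k)) at_top sequentially"
      using s(2) r by (intro filterlim_compose[OF s(2)] filterlim_subseq)
    then have "p \<in> S" using s(1) p by (intro limit[of "\<lambda>k. s (r k)"]) (auto simp: o_def)
    then show ?thesis using r p by (auto simp: o_def)
  qed
  have *: "filterlim (\<lambda>k. max c (real k)) at_top sequentially"
    using filterlim_real_sequentially by (rule filterlim_at_top_mono) auto
  have "S \<noteq> {}" using cluster[OF _ *] by auto
  moreover have "((\<lambda>t. infdist (x t) S) \<longlongrightarrow> 0) at_top"
  proof (rule ccontr)
    assume "\<not> ?thesis"
    then obtain e where "e > 0" and "\<not> (\<forall>\<^sub>F t in at_top. infdist (x t) S < e)"
      unfolding tendsto_iff by (auto simp: infdist_nonneg)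
    then have "\<forall>k::nat. \<exists>t. t \<ge> max c (real k) \<and> infdist (x t) S \<ge> e"
      unfolding eventually_at_top_linorder not_ex not_all not_imp not_less by blast
    from choice[OF this] obtain s where s: "\<And>k::nat. s k \<ge> max c (real k)"
        "\<And>k. infdist (x (s k)) S \<ge> e"
      by blast
    have "filterlim s at_top sequentially"
      using * by (rule filterlim_at_top_mono) (use s(1) in auto)
    then obtain p r where "p \<in> S" and lim: "(\<lambda>k. x (s (r k))) \<longlonglongrightarrow> p"
      using cluster[of s] s(1) by auto
    from lim have "\<forall>\<^sub>F k in sequentially. dist (x (s (r k))) p < e"
      using \<open>e > 0\<close> by (simp add: tendsto_iff)
    then obtain k where "dist (x (s (r k))) p < e"
      using eventually_happens' sequentially_bot by blast
    then show False
      using infdist_le[OF \<open>p \<in> S\<close>, of "x (s (r k))"] s(2)[of "r k"] by linarith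
  qed
  ultimately show ?thesis unfolding converges_to_set_def by blast
qed

text \<open>
  If some \<open>z\<close> were better than the limit point \<open>p\<close> in every objective, then each gap
  \<open>f i (x (s k)) - f i z\<close> would tend to a positive number, and multiplied by \<open>(s k)\<^sup>2\<close>
  it would exceed every bound.
\<close>
lemma limit_point_weakly_pareto:
  fixes f :: "'m::finite \<Rightarrow> 'a::topological_space \<Rightarrow> real"
  assumes cont: "\<And>i. continuous_on UNIV (f i)"
    and bound: "\<And>z. \<exists>K. \<forall>t\<ge>c. \<exists>i. t\<^sup>2 * (f i (x t) - f i z) \<le> K"
    and s: "\<And>k::nat. s k \<ge> c" "filterlim s at_top sequentially" "(\<lambda>k. x (s k)) \<longlonglongrightarrow> p"
  shows "p \<in> weakly_pareto_set f"
proof -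
  have False if z: "\<forall>i. f i z < f i p" for z
  proof -
    obtain K where K: "\<And>t. t \<ge> c \<Longrightarrow> \<exists>i. t\<^sup>2 * (f i (x t) - f i z) \<le> K" using bound by blast
    have "\<forall>\<^sub>F k in sequentially. K < (s k)\<^sup>2 * (f i (x (s k)) - f i z)" for i
    proof -
      have "(\<lambda>k. f i (x (s k))) \<longlonglongrightarrow> f i p"
        using s(3) by (rule continuous_on_tendsto_compose[OF cont]) auto
      then have "(\<lambda>k. f i (x (s k)) - f i z) \<longlonglongrightarrow> f i p - f i z"
        by (intro tendsto_intros)
      moreover have "filterlim (\<lambda>k. (s k)\<^sup>2) at_top sequentially"
        using filterlim_pow_at_top[OF _ s(2), of 2] by simp
      ultimately have "filterlim (\<lambda>k. (s k)\<^sup>2 * (f i (x (s k)) - f i z)) at_top sequentially"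
        using z by (intro filterlim_at_top_mult_tendsto_pos[where c = "f i p - f i z"]) auto
      then show ?thesis by (simp add: filterlim_at_top_dense)
    qed
    then have "\<forall>\<^sub>F k in sequentially. \<forall>i. K < (s k)\<^sup>2 * (f i (x (s k)) - f i z)"
      by (intro eventually_all_finite)
    then obtain k where "\<forall>i. K < (s k)\<^sup>2 * (f i (x (s k)) - f i z)"
      using eventually_happens' sequentially_bot by blast
    then show False using K[OF s(1)] by (meson not_less)
  qed
  then show ?thesis unfolding weakly_pareto_set_def by blast
qed

section \<open>Convergence to the weakly Pareto optimal set\<close>
theorem theorem3p8:
  fixes f :: "'m::finite \<Rightarrow> real ^ 'n \<Rightarrow> real"
    and g :: "'m \<Rightarrow> real ^ 'n \<Rightarrow> real ^ 'n"
    and L :: "'m \<Rightarrow> real"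
    and x0 :: "real ^ 'n"
    and x :: "real \<Rightarrow> real ^ 'n"
  assumes convex: "\<And>i. convex_on UNIV (f i)"
    and gradient: "\<And>i y. GDERIV (f i) y :> g i y"
    and gradient_continuous: "\<And>i. continuous_on UNIV (g i)"
    and gradient_Lipschitz: "\<And>i y z. norm (g i y - g i z) \<le> L i * norm (y - z)"
    and level_sets_bounded: "\<And>xbar. bounded (level_set f (\<lambda>i. f i xbar))"
    and solution: "cauchy_solution 3 g x0 x"
  shows "converges_to_set x (weakly_pareto_set f)"
proof -
  obtain v where v: "velocity_solution 3 g x v" "v 1 = 0"
    using cauchy_solution_velocity[OF solution] by auto
  have "f i (x t) \<le> f i (x 1)" if "t \<ge> 1" for i t
    using mechanical_energy_nonincreasing[OF gradient gradient_continuous v(1) _ that, of i] v(2)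
      inner_ge_zero[of "v t"] by (simp del: inner_ge_zero)
  then have "x ` {1..} \<subseteq> level_set f (\<lambda>i. f i (x 1))"
    by (auto simp: level_set_def)
  then have bdd: "bounded (x ` {1..})"
    using level_sets_bounded bounded_subset by blast
  have f_cont: "continuous_on UNIV (f i)" for i
    by (rule has_derivative_continuous_on[where f' = "\<lambda>y h. h \<bullet> g i y"])
      (use gradient in \<open>simp add: gderiv_def\<close>)
  have decay: "\<exists>K. \<forall>t\<ge>1. \<exists>i. t\<^sup>2 * (f i (x t) - f i z) \<le> K" for z
  proof -
    define E where "E i t = t\<^sup>2 * (f i (x t) - f i z) + (norm (2 *\<^sub>R (x t - z) + t *\<^sub>R v t))\<^sup>2 / 2" for i t
    have "\<exists>i. t\<^sup>2 * (f i (x t) - f i z) \<le> (MIN i. E i 1)" if "t \<ge> 1" for t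
    proof -
      obtain i where "E i t = (MIN i. E i t)"
        using Min_in[of "range (\<lambda>i. E i t)"] by fastforce
      also have "\<dots> \<le> (MIN i. E i 1)"
        using lyapunov_nonincreasing[OF gradient gradient_continuous v(1) _ convex that]
        unfolding E_def by simp
      finally have "E i t \<le> (MIN i. E i 1)" .
      moreover have "t\<^sup>2 * (f i (x t) - f i z) \<le> E i t" by (simp add: E_def)
      ultimately show ?thesis by (intro exI[of _ i]) (rule order_trans)
    qed
    then show ?thesis by blast
  qed
  show ?thesis
    using bdd by (rule converges_to_set_if_limit_points)
      (rule limit_point_weakly_pareto[OF f_cont decay])
qed

end
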